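(* Let $\mathcal{C}$ be a finite family of grounded $x$-monotone curves in the plane and let $G$ be its disjointness graph. If $\omega(G)=k$, then $\chi(G)\leq \binom{k+1}{2}$.
   Context: A curve is the image of a continuous map $\phi:[0,1]\to\mathbb{R}^2$. A curve is $x$-monotone if every vertical line meets it in at most one point. A grounded $x$-monotone curve is an $x$-monotone curve contained in the half-plane $\{x\geq 0\}$ whose left endpoint lies on the line $\{x=0\}$. The disjointness graph of a family of curves has the curves as vertices, two vertices being adjacent if and only if the corresponding curves are disjoint. $\omega$ and $\chi$ denote clique number and chromatic number. *)

theory Defs
  imports "HOL-Analysis.Analysis" "HOL-Library.Ramsey"
begin

definition plane_curve :: "(real \<times> real) set \<Rightarrow> bool"
  where "plane_curve C \<longleftrightarrow> (\<exists>\<phi>. path \<phi> \<and> path_image \<phi> = C)"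

definition x_monotone :: "(real \<times> real) set \<Rightarrow> bool"
  where "x_monotone C \<longleftrightarrow> (\<forall>a. \<exists>\<^sub>\<le>\<^sub>1 p. p \<in> C \<and> fst p = a)"

text \<open>A curve is a point set without a distinguished parametrization, so its left endpoint is its
  leftmost point, not an end of a path. On \<^const>\<open>x_monotone\<close> curves this point exists and is
  unique. A single point is a (degenerate) curve.\<close>

definition left_endpoint :: "(real \<times> real) set \<Rightarrow> real \<times> real \<Rightarrow> bool"
  where "left_endpoint C p \<longleftrightarrow> p \<in> C \<and> (\<forall>q\<in>C. fst p \<le> fst q)"

definition grounded_x_monotone_curve :: "(real \<times> real) set \<Rightarrow> bool"
  where "grounded_x_monotone_curve C \<longleftrightarrow>
    plane_curve C \<and> x_monotone C \<and> C \<subseteq> {p. fst p \<ge> 0} \<and> (\<exists>p. left_endpoint C p \<and> fst p = 0)"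

text \<open>As in \<^theory>\<open>HOL-Library.Ramsey\<close>, a graph is given by a vertex set \<open>V\<close> and a set \<open>E\<close> of
  two-element edges, and cliques are those of \<^const>\<open>clique\<close>.\<close>

definition disjointness_edges :: "'a set set \<Rightarrow> 'a set set set"
  where "disjointness_edges V = {{A, B} | A B. A \<in> V \<and> B \<in> V \<and> A \<noteq> B \<and> A \<inter> B = {}}"

text \<open>\<open>clique_number\<close> and \<open>chromatic_number\<close> are meaningful for finite \<open>V\<close> only: otherwise
  \<^const>\<open>Max\<close> or \<^const>\<open>Least\<close> may be unspecified. For \<open>V = {}\<close> both are \<open>0\<close>.\<close>

definition clique_number :: "'v set \<Rightarrow> 'v set set \<Rightarrow> nat"
  where "clique_number V E = Max {card K | K. K \<subseteq> V \<and> clique K E}"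

definition proper_colouring :: "'v set \<Rightarrow> 'v set set \<Rightarrow> nat \<Rightarrow> ('v \<Rightarrow> nat) \<Rightarrow> bool"
  where "proper_colouring V E n c \<longleftrightarrow>
    c ` V \<subseteq> {..<n} \<and> (\<forall>u\<in>V. \<forall>v\<in>V. {u, v} \<in> E \<longrightarrow> c u \<noteq> c v)"

definition chromatic_number :: "'v set \<Rightarrow> 'v set set \<Rightarrow> nat"
  where "chromatic_number V E = (LEAST n. \<exists>c. proper_colouring V E n c)"

end

(* Grounded x-monotone curves are graphs of continuous functions on intervals {0..L}, so by the
   intermediate value theorem one of two disjoint curves runs below the other over their common
   projection.  Splitting "A is below B" according to which of the two projections is the shorter
   one gives two strict partial orders, A <1 B (A shorter) and A <2 B (B shorter), whose union
   orients the disjointness graph.  Colour A by the pair (p, q), where p is the maximal size of a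
   <1-chain with top A and q the maximal size of a <2-chain with bottom A; this is proper.  If
   D <1 A <2 B, then A is defined wherever both D and B are, so D is below B.  Hence the two chains
   together form a clique with p + q - 1 \<le> k vertices, which leaves (k + 1) choose 2 pairs. *)

theory Submission
  imports Defs "HOL-Library.Nat_Bijection"
begin

section \<open>Heights of elements in a finite strict order\<close>

text \<open>Chains are kept as sets so that they can later serve as vertex sets of cliques. Applied
  to the converse of an order, the same definition gives chains with bottom
  \<open>v\<close>.\<close>

definition chains_below :: "('a \<Rightarrow> 'a \<Rightarrow> bool) \<Rightarrow> 'a set \<Rightarrow> 'a \<Rightarrow> 'a set set"
  where "chains_below R V v =
    {K. K \<subseteq> V \<and> v \<in> K \<and> (\<forall>x\<in>K. x \<noteq> v \<longrightarrow> R x v) \<and>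
        (\<forall>x\<in>K. \<forall>y\<in>K. x \<noteq> y \<longrightarrow> R x y \<or> R y x)}"

definition height :: "('a \<Rightarrow> 'a \<Rightarrow> bool) \<Rightarrow> 'a set \<Rightarrow> 'a \<Rightarrow> nat"
  where "height R V v = Max (card ` chains_below R V v)"

lemma finite_chains_below: "finite V \<Longrightarrow> finite (chains_below R V v)"
  by (rule finite_subset[of _ "Pow V"]) (auto simp: chains_below_def)

lemma singleton_in_chains_below: "v \<in> V \<Longrightarrow> {v} \<in> chains_below R V v"
  by (simp add: chains_below_def)

lemma card_le_height: "finite V \<Longrightarrow> K \<in> chains_below R V v \<Longrightarrow> card K \<le> height R V v"
  by (simp add: height_def finite_chains_below)

lemma height_attained:
  assumes "finite V" "v \<in> V"
  obtains K where "K \<in> chains_below R V v" "card K = height R V v"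
proof -
  have "height R V v \<in> card ` chains_below R V v"
    unfolding height_def
    using finite_chains_below[OF assms(1)] singleton_in_chains_below[OF assms(2)]
    by (intro Max_in) blast+
  then show thesis
    using that by auto
qed

lemma height_pos: "finite V \<Longrightarrow> v \<in> V \<Longrightarrow> 0 < height R V v"
  using card_le_height[OF _ singleton_in_chains_below, of V v R] by simp

text \<open>A longest chain with top \<open>u\<close> extends by \<open>v\<close>: transitivity puts
  all its elements below \<open>v\<close>, and irreflexivity makes \<open>v\<close> new.\<close>

lemma height_less:
  assumes "finite V" "u \<in> V" "v \<in> V" "R u v"
    and irrefl: "\<And>x. x \<in> V \<Longrightarrow> \<not> R x x"
    and trans: "\<And>x y z. x \<in> V \<Longrightarrow> y \<in> V \<Longrightarrow> z \<in> V \<Longrightarrow> R x y \<Longrightarrow> R y z \<Longrightarrow> R x z"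
  shows "height R V u < height R V v"
proof -
  obtain K where K: "K \<in> chains_below R V u" "card K = height R V u"
    using height_attained assms(1,2) by metis
  have below_v: "R x v" if "x \<in> K" for x
    using that K(1) assms(2-4) trans[of x u v] by (cases "x = u") (auto simp: chains_below_def)
  then have "v \<notin> K"
    using irrefl assms(3) by blast
  moreover have "finite K"
    using K(1) assms(1) by (auto simp: chains_below_def intro: finite_subset)
  moreover have "insert v K \<in> chains_below R V v"
    using K(1) below_v assms(3) by (auto simp: chains_below_def)
  ultimately show ?thesis
    using card_le_height[OF assms(1)] K(2) by fastforce
qed

section \<open>Colouring by pairs of heights\<close>

lemma triangle_eq_choose: "triangle n = (n + 1) choose 2"
  by (simp add: triangle_def choose_two mult.commute)

text \<open>\<open>prod_encode\<close> runs through the pairs diagonal by diagonal, and the first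
  \<open>k\<close> diagonals hold \<open>triangle k\<close> pairs. So the pairs of heights become
  colours in an initial segment of the naturals.\<close>

lemma prod_encode_less_triangle:
  assumes "i + j < k"
  shows "prod_encode (i, j) < triangle k"
proof -
  have "prod_encode (i, j) < triangle (Suc (i + j))"
    by (simp add: prod_encode_def)
  also have "\<dots> \<le> triangle k"
    by (rule lift_Suc_mono_le[of triangle]) (use assms in simp_all)
  finally show ?thesis .
qed

lemma card_le_clique_number:
  assumes "finite V" "K \<subseteq> V" "clique K E"
  shows "card K \<le> clique_number V E"
  unfolding clique_number_def using assms
  by (intro Max_ge finite_subset[of "{card K | K. K \<subseteq> V \<and> clique K E}" "card ` Pow V"]) auto

lemma chromatic_number_le: "proper_colouring V E n c \<Longrightarrow> chromatic_number V E \<le> n"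
  unfolding chromatic_number_def by (blast intro: Least_le)

text \<open>\<open>PQ\<close> is the law needed to join a \<open>P\<close>-chain ending at
  \<open>v\<close> to a \<open>Q\<close>-chain starting at \<open>v\<close>; it links every element
  of the first to every element of the second.\<close>

lemma chromatic_number_le_two_orders:
  assumes fin: "finite V"
    and P_irrefl: "\<And>x. x \<in> V \<Longrightarrow> \<not> P x x"
    and Q_irrefl: "\<And>x. x \<in> V \<Longrightarrow> \<not> Q x x"
    and P_trans: "\<And>x y z. x \<in> V \<Longrightarrow> y \<in> V \<Longrightarrow> z \<in> V \<Longrightarrow> P x y \<Longrightarrow> P y z \<Longrightarrow> P x z"
    and Q_trans: "\<And>x y z. x \<in> V \<Longrightarrow> y \<in> V \<Longrightarrow> z \<in> V \<Longrightarrow> Q x y \<Longrightarrow> Q y z \<Longrightarrow> Q x z"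
    and PQ: "\<And>x y z. x \<in> V \<Longrightarrow> y \<in> V \<Longrightarrow> z \<in> V \<Longrightarrow> P x y \<Longrightarrow> Q y z \<Longrightarrow> P x z \<or> Q x z"
    and edge: "\<And>x y. x \<in> V \<Longrightarrow> y \<in> V \<Longrightarrow> {x, y} \<in> E \<longleftrightarrow> P x y \<or> Q x y \<or> P y x \<or> Q y x"
  shows "chromatic_number V E \<le> (clique_number V E + 1) choose 2"
proof -
  define p where "p = height P V"
  define q where "q = height (\<lambda>x y. Q y x) V"
  \<comment> \<open>Heights start at 1. After the shift, p + q \<le> \<omega> + 1 becomes a
    coordinate sum below \<omega>, and positivity keeps the truncated subtraction injective.\<close>
  define c where "c = (\<lambda>v. prod_encode (p v - 1, q v - 1))"
  have pos: "0 < p v" "0 < q v" if "v \<in> V" for v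
    using that fin by (simp_all add: p_def q_def height_pos)
  have p_less: "p u < p v" if "u \<in> V" "v \<in> V" "P u v" for u v
    unfolding p_def using fin that P_irrefl P_trans by (rule height_less)
  have q_less: "q v < q u" if "u \<in> V" "v \<in> V" "Q u v" for u v
    unfolding q_def by (rule height_less) (use fin that Q_irrefl Q_trans in blast)+
  have sum_le: "p v + q v \<le> clique_number V E + 1" if v: "v \<in> V" for v
  proof -
    obtain K where K: "K \<in> chains_below P V v" "card K = p v"
      using height_attained[OF fin v] unfolding p_def by metis
    obtain L where L: "L \<in> chains_below (\<lambda>x y. Q y x) V v" "card L = q v"
      using height_attained[OF fin v] unfolding q_def by metis
    have sub: "K \<subseteq> V" "L \<subseteq> V"
      using K(1) L(1) by (auto simp: chains_below_def)
    have KL: "P x y \<or> Q x y" if "x \<in> K" "y \<in> L" "x \<noteq> v \<or> y \<noteq> v" for x y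
    proof -
      have "x = v \<or> P x v" "y = v \<or> Q v y" "x \<in> V" "y \<in> V"
        using that K(1) L(1) by (auto simp: chains_below_def)
      then show ?thesis
        using PQ[of x v y] that(3) v by blast
    qed
    have "v \<in> K" "v \<in> L"
      using K(1) L(1) by (auto simp: chains_below_def)
    \<comment> \<open>A common element other than \<open>v\<close> would be related to itself by
      \<open>KL\<close>. Hence the chains share only \<open>v\<close>, and their union has p + q - 1
      elements.\<close>
    moreover have "x = v" if "x \<in> K" "x \<in> L" for x
      using KL[OF that] P_irrefl[of x] Q_irrefl[of x] sub(1) that(1) by blast
    ultimately have "K \<inter> L = {v}"
      by blast
    then have "card K + card L = card (K \<union> L) + 1"
      using card_Un_Int[of K L] finite_subset[OF _ fin] sub by simp
    moreover have "clique (K \<union> L) E"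
      unfolding clique_def
    proof (intro ballI impI)
      fix x y assume xy: "x \<in> K \<union> L" "y \<in> K \<union> L" "x \<noteq> y"
      then consider "x \<in> K" "y \<in> K" | "x \<in> L" "y \<in> L" | "x \<in> K" "y \<in> L" | "x \<in> L" "y \<in> K"
        by blast
      then have "P x y \<or> Q x y \<or> P y x \<or> Q y x"
      proof cases
        case 1
        then show ?thesis using K(1) xy(3) by (auto simp: chains_below_def)
      next
        case 2
        then show ?thesis using L(1) xy(3) by (auto simp: chains_below_def)
      next
        case 3
        then show ?thesis using KL[of x y] xy(3) by blast
      next
        case 4
        then show ?thesis using KL[of y x] xy(3) by blast
      qed
      then show "{x, y} \<in> E"
        using edge[of x y] xy sub by blast
    qed
    ultimately show ?thesis
      using card_le_clique_number[OF fin, of "K \<union> L" E] sub K(2) L(2) by simp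
  qed
  have "c v < triangle (clique_number V E)" if "v \<in> V" for v
    unfolding c_def using pos[OF that] sum_le[OF that] by (intro prod_encode_less_triangle) linarith
  moreover have "c u \<noteq> c v" if uv: "u \<in> V" "v \<in> V" and "{u, v} \<in> E" for u v
  proof -
    have "p u \<noteq> p v \<or> q u \<noteq> q v"
      using edge[OF uv] that p_less[of u v] p_less[of v u] q_less[of u v] q_less[of v u]
      by auto
    then show ?thesis
      using pos[OF uv(1)] pos[OF uv(2)] by (auto simp: c_def)
  qed
  ultimately have "proper_colouring V E (triangle (clique_number V E)) c"
    by (auto simp: proper_colouring_def)
  then show ?thesis
    using chromatic_number_le by (metis triangle_eq_choose)
qed

section \<open>Grounded curves as graphs of functions\<close>

text \<open>The first projection is injective on the compact set \<open>C\<close>, so its inverse is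
  continuous; \<open>f\<close> is the second coordinate of that inverse. The projection of
  \<open>C\<close> is compact and connected, hence an interval, and grounding makes it start at
  0.\<close>

lemma grounded_curve_is_graph:
  assumes "grounded_x_monotone_curve C"
  obtains L f where "0 \<le> L" "continuous_on {0..L} f" "C = (\<lambda>x. (x, f x)) ` {0..L}"
proof -
  obtain \<phi> where \<phi>: "path \<phi>" "path_image \<phi> = C"
    using assms by (auto simp: grounded_x_monotone_curve_def plane_curve_def)
  obtain p where p: "p \<in> C" "fst p = 0"
    using assms by (auto simp: grounded_x_monotone_curve_def left_endpoint_def)
  have nonneg: "fst q \<ge> 0" if "q \<in> C" for q
    using assms that by (auto simp: grounded_x_monotone_curve_def)
  have inj: "inj_on fst C"
    using assms
    by (auto simp: grounded_x_monotone_curve_def x_monotone_def Uniq_def inj_on_def)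
  have "compact C" "connected C"
    using \<phi> compact_path_image connected_path_image by blast+
  then have "compact (fst ` C)" "connected (fst ` C)"
    by (auto intro!: compact_continuous_image connected_continuous_image continuous_intros)
  then obtain a L where aL: "fst ` C = {a..L}"
    by (metis connected_compact_interval_1)
  have "0 \<in> {a..L}"
    using p aL by (metis image_eqI)
  moreover have "a \<in> fst ` C"
    using calculation by (simp add: aL)
  ultimately have "a = 0" "0 \<le> L"
    using nonneg by fastforce+
  define g where "g = the_inv_into C fst"
  have g: "g (fst q) = q" if "q \<in> C" for q
    using that inj by (simp add: g_def the_inv_into_f_f)
  have "continuous_on (fst ` C) g"
    using \<open>compact C\<close> g by (intro continuous_on_inv continuous_intros) auto
  then have "continuous_on {0..L} (\<lambda>x. snd (g x))"
    using aL \<open>a = 0\<close> by (auto intro: continuous_on_snd)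
  moreover have "C = (\<lambda>x. (x, snd (g x))) ` fst ` C"
    using g by (force simp: image_image)
  ultimately show thesis
    using that \<open>0 \<le> L\<close> aL \<open>a = 0\<close> by metis
qed

text \<open>Only common abscissae are compared, so the relation is not transitive in general: the
  middle set may be missing over an abscissa shared by the outer two.\<close>

definition below :: "(real \<times> real) set \<Rightarrow> (real \<times> real) set \<Rightarrow> bool"
  where "below A B \<longleftrightarrow> (\<forall>x y z. (x, y) \<in> A \<longrightarrow> (x, z) \<in> B \<longrightarrow> y < z)"

lemma below_imp_disjoint: "below A B \<Longrightarrow> A \<inter> B = {}"
  by (fastforce simp: below_def)

lemma below_trans:
  assumes "below A B" "below B C" "fst ` A \<inter> fst ` C \<subseteq> fst ` B"
  shows "below A C"
  unfolding below_def
proof (intro allI impI)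
  fix x y z assume yz: "(x, y) \<in> A" "(x, z) \<in> C"
  then have "x \<in> fst ` B"
    using assms(3) by force
  then obtain w where "(x, w) \<in> B"
    by auto
  then show "y < z"
    using assms(1,2) yz unfolding below_def by (meson less_trans)
qed

lemma not_below_self: "A \<noteq> {} \<Longrightarrow> \<not> below A A"
  using below_imp_disjoint by blast

text \<open>Both projections are intervals with left end 0, so they are nested.\<close>

lemma fst_image_grounded_linear:
  assumes "grounded_x_monotone_curve A" "grounded_x_monotone_curve B"
  shows "fst ` A \<subseteq> fst ` B \<or> fst ` B \<subseteq> fst ` A"
proof -
  obtain L f M g where "A = (\<lambda>x. (x, f x)) ` {0..L}" "B = (\<lambda>x. (x, g x)) ` {0..M}"
    using assms grounded_curve_is_graph by metis
  then show ?thesis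
    by (simp add: image_image) linarith
qed

lemma disjoint_grounded_imp_below:
  assumes "grounded_x_monotone_curve A" "grounded_x_monotone_curve B" "A \<inter> B = {}"
  shows "below A B \<or> below B A"
proof -
  obtain L f where f: "continuous_on {0..L} f" "A = (\<lambda>x. (x, f x)) ` {0..L}"
    using assms(1) grounded_curve_is_graph by metis
  obtain M g where g: "continuous_on {0..M} g" "B = (\<lambda>x. (x, g x)) ` {0..M}"
    using assms(2) grounded_curve_is_graph by metis
  define I where "I = {0..min L M}"
  define h where "h = (\<lambda>x. g x - f x)"
  have "continuous_on I h"
    unfolding h_def I_def
    by (intro continuous_intros continuous_on_subset[OF f(1)] continuous_on_subset[OF g(1)]) auto
  then have conn: "connected (h ` I)"
    by (intro connected_continuous_image) (auto simp: I_def)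
  have "(x, f x) \<in> A" "(x, g x) \<in> B" if "x \<in> I" for x
    using that f(2) g(2) by (auto simp: I_def)
  then have nz: "0 \<notin> h ` I"
    using assms(3) by (force simp: h_def)
  \<comment> \<open>The image of \<open>h\<close> is connected and omits 0, so it cannot have points
    on both sides of 0.\<close>
  have "(\<forall>x\<in>I. 0 < h x) \<or> (\<forall>x\<in>I. h x < 0)"
  proof (rule ccontr)
    assume "\<not> ?thesis"
    then obtain x y where "x \<in> I" "y \<in> I" "h x \<le> 0" "0 \<le> h y"
      by (auto simp: not_less)
    then show False
      using connectedD_interval[OF conn, of "h x" "h y" 0] nz by blast
  qed
  then show ?thesis
    using f(2) g(2) by (auto simp: below_def h_def I_def)
qed

section \<open>The chromatic number of the disjointness graph\<close>

theorem theorem1: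
  fixes \<C> :: "(real \<times> real) set set" and k :: nat
  assumes "finite \<C>"
    and "\<And>C. C \<in> \<C> \<Longrightarrow> grounded_x_monotone_curve C"
    and "clique_number \<C> (disjointness_edges \<C>) = k"
  shows "chromatic_number \<C> (disjointness_edges \<C>) \<le> (k + 1) choose 2"
proof -
  \<comment> \<open>Curves with equal projections satisfy both inclusions, so \<open>P\<close> and
    \<open>Q\<close> may overlap.\<close>
  define P where "P = (\<lambda>A B. below A B \<and> fst ` A \<subseteq> fst ` B)"
  define Q where "Q = (\<lambda>A B. below A B \<and> fst ` B \<subseteq> fst ` A)"
  have nonempty: "A \<noteq> {}" if "A \<in> \<C>" for A
    using assms(2)[OF that] by (auto simp: grounded_x_monotone_curve_def left_endpoint_def)
  have PQ_iff: "P A B \<or> Q A B \<longleftrightarrow> below A B" if "A \<in> \<C>" "B \<in> \<C>" for A B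
    using fst_image_grounded_linear[OF assms(2)[OF that(1)] assms(2)[OF that(2)]]
    by (auto simp: P_def Q_def)
  have edge: "{A, B} \<in> disjointness_edges \<C> \<longleftrightarrow> below A B \<or> below B A"
    if "A \<in> \<C>" "B \<in> \<C>" for A B
  proof -
    have "{A, B} \<in> disjointness_edges \<C> \<longleftrightarrow> A \<noteq> B \<and> A \<inter> B = {}"
      using that by (auto simp: disjointness_edges_def doubleton_eq_iff)
    also have "\<dots> \<longleftrightarrow> below A B \<or> below B A"
      \<comment> \<open>Nonemptiness rules out \<open>below A A\<close>, which yields
        \<open>A \<noteq> B\<close> in the backward direction.\<close>
      using that assms(2) nonempty disjoint_grounded_imp_below below_imp_disjoint
      by (metis Int_commute inf.idem)
    finally show ?thesis .
  qed
  have "chromatic_number \<C> (disjointness_edges \<C>)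
      \<le> (clique_number \<C> (disjointness_edges \<C>) + 1) choose 2"
  proof (rule chromatic_number_le_two_orders[OF assms(1), where P = P and Q = Q])
    fix A assume "A \<in> \<C>"
    then show "\<not> P A A" "\<not> Q A A"
      using nonempty not_below_self by (auto simp: P_def Q_def)
  next
    fix A B C assume "P A B" "P B C"
    then show "P A C"
      using below_trans[of A B C] by (auto simp: P_def)
  next
    fix A B C assume "Q A B" "Q B C"
    then show "Q A C"
      using below_trans[of A B C] unfolding Q_def by (meson Int_lower2 order_trans)
  next
    \<comment> \<open>Here \<open>B\<close> has the longest projection, so
      \<open>below_trans\<close> applies; whether \<open>P\<close> or \<open>Q\<close> results
      depends on which of \<open>A\<close> and \<open>C\<close> is shorter.\<close>
    fix A B C assume "A \<in> \<C>" "C \<in> \<C>" "P A B" "Q B C"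
    then show "P A C \<or> Q A C"
      using below_trans[of A B C] PQ_iff[of A C] by (auto simp: P_def Q_def)
  next
    fix A B assume "A \<in> \<C>" "B \<in> \<C>"
    then show "{A, B} \<in> disjointness_edges \<C> \<longleftrightarrow> P A B \<or> Q A B \<or> P B A \<or> Q B A"
      using edge[of A B] PQ_iff[of A B] PQ_iff[of B A] by blast
  qed
  then show ?thesis
    using assms(3) by simp
qed

end
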